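(* (1) Let $f_1,f_2,g\in C([0,1])$ and $\alpha,\beta\in\mathbb R$. If the Faber--Schauder integrals $I_{f_1,g}$ and $I_{f_2,g}$ exist on $[0,1]$, then $I_{\alpha f_1+\beta f_2,g}$ also exists on $[0,1]$, and for every $t\in[0,1]$, $I_{\alpha f_1+\beta f_2,g}(t)=\alpha I_{f_1,g}(t)+\beta I_{f_2,g}(t)$. Consequently, for every $s,t\in[0,1]$, $$\int_s^t(\alpha f_1+\beta f_2)\,dg=\alpha\int_s^t f_1\,dg+\beta\int_s^t f_2\,dg.$$ (2) Let $f,g_1,g_2\in C([0,1])$ and $\alpha,\beta\in\mathbb R$. If $I_{f,g_1}$ and $I_{f,g_2}$ exist on $[0,1]$, then $I_{f,\alpha g_1+\beta g_2}$ also exists on $[0,1]$, and for every $t\in[0,1]$, $I_{f,\alpha g_1+\beta g_2}(t)=\alpha I_{f,g_1}(t)+\beta I_{f,g_2}(t)$; consequently, for every $s,t\in[0,1]$, $$\int_s^t f\,d(\alpha g_1+\beta g_2)=\alpha\int_s^t f\,dg_1+\beta\int_s^t f\,dg_2.$$ (3) Let $f,g\in C([0,1])$. If $I_{f,g}$ exists on $[0,1]$, then $$\int_r^t f\,dg=\int_r^s f\,dg+\int_s^t f\,dg,\qquad r,s,t\in[0,1].$$ In particular, $\int_s^s f\,dg=0$ and $\int_s^t f\,dg=-\int_t^s f\,dg$.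
   Context: $C([0,1])$ denotes the real-valued continuous functions on $[0,1]$. For $n\in\{0,1,2,\dots\}$: $t_{n,k}=k2^{-n}$ for $0\le k\le 2^n$, $\mathbb T_n=\{t_{n,k}:0\le k\le 2^n\}$, $\mathbb T=\bigcup_{n\ge0}\mathbb T_n$; for $t\in\mathbb T$, $\ell(t)=\min\{m\ge0:t\in\mathbb T_m\}$. Dyadic left sums: for $f,g\in C([0,1])$, $t\in\mathbb T$, $n\ge\ell(t)$, $$S_n^L(t;f,g)=\sum_{k=0}^{2^nt-1}f(t_{n,k})\big(g(t_{n,k+1})-g(t_{n,k})\big)$$ (empty sum $=0$). The dyadic integral over $[0,t]$ exists if $(S_n^L(t;f,g))_{n\ge\ell(t)}$ converges, and its limit is denoted $I^{\mathbb T}_{f,g}(t)$. Faber--Schauder integral: if $I^{\mathbb T}_{f,g}(t)$ exists for every $t\in\mathbb T$ and the map $I^{\mathbb T}_{f,g}:\mathbb T\to\mathbb R$ admits a (necessarily unique) continuous extension to $[0,1]$, this extension is denoted $I_{f,g}:[0,1]\to\mathbb R$ and one says that the Faber--Schauder integral $I_{f,g}$ exists on $[0,1]$. In that case $\int_s^t f\,dg:=I_{f,g}(t)-I_{f,g}(s)$ for all $s,t\in[0,1]$. *)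

theory Defs
  imports "HOL-Analysis.Analysis" "HOL-Library.FuncSet"
begin

text \<open>
  An element of \<open>C([0,1])\<close> is represented by a function of type \<open>real \<Rightarrow> real\<close> that is continuous on
  \<open>{0..1}\<close>. Its values outside \<open>{0..1}\<close> never enter the definitions below.
\<close>

definition dyadic_pt :: "nat \<Rightarrow> nat \<Rightarrow> real" where
  "dyadic_pt n k = real k / 2 ^ n"

definition dyadic_grid :: "nat \<Rightarrow> real set" where
  "dyadic_grid n = {dyadic_pt n k | k. k \<le> 2 ^ n}"

definition dyadics :: "real set" where
  "dyadics = (\<Union>n. dyadic_grid n)"

definition dyadic_level :: "real \<Rightarrow> nat" where
  "dyadic_level t = (LEAST m. t \<in> dyadic_grid m)"

text \<open>
  The floor only converts the type: for \<open>t \<in> dyadics\<close> and \<open>n \<ge> dyadic_level t\<close> the number \<open>2 ^ n * t\<close>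
  is a natural number (see \<open>two_power_mult_dyadic\<close>), and these are the only arguments used below.
\<close>

definition left_sum :: "nat \<Rightarrow> real \<Rightarrow> (real \<Rightarrow> real) \<Rightarrow> (real \<Rightarrow> real) \<Rightarrow> real" where
  "left_sum n t f g =
    (\<Sum>k<nat \<lfloor>2 ^ n * t\<rfloor>. f (dyadic_pt n k) * (g (dyadic_pt n (k + 1)) - g (dyadic_pt n k)))"

text \<open>The sequence \<open>left_sum n t f g\<close>, \<open>n \<ge> dyadic_level t\<close>, is indexed from \<open>0\<close> by a shift.\<close>

definition dyadic_integral_exists :: "(real \<Rightarrow> real) \<Rightarrow> (real \<Rightarrow> real) \<Rightarrow> real \<Rightarrow> bool" where
  "dyadic_integral_exists f g t \<longleftrightarrow> convergent (\<lambda>m. left_sum (dyadic_level t + m) t f g)"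

definition dyadic_integral :: "(real \<Rightarrow> real) \<Rightarrow> (real \<Rightarrow> real) \<Rightarrow> real \<Rightarrow> real" where
  "dyadic_integral f g t = lim (\<lambda>m. left_sum (dyadic_level t + m) t f g)"

text \<open>
  A function \<open>[0,1] \<Rightarrow> \<real>\<close> is represented by a function that is \<open>extensional\<close> on \<open>{0..1}\<close>, so that the
  continuous extension is unique (see \<open>continuous_extension_unique\<close>) and \<open>THE\<close> is justified below.
\<close>

definition is_continuous_extension :: "(real \<Rightarrow> real) \<Rightarrow> (real \<Rightarrow> real) \<Rightarrow> bool" where
  "is_continuous_extension h F \<longleftrightarrow>
    F \<in> extensional {0..1} \<and> continuous_on {0..1} F \<and> (\<forall>t\<in>dyadics. F t = h t)"

definition FS_integral_exists :: "(real \<Rightarrow> real) \<Rightarrow> (real \<Rightarrow> real) \<Rightarrow> bool" where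
  "FS_integral_exists f g \<longleftrightarrow>
    (\<forall>t\<in>dyadics. dyadic_integral_exists f g t) \<and>
    (\<exists>F. is_continuous_extension (dyadic_integral f g) F)"

definition FS_integral :: "(real \<Rightarrow> real) \<Rightarrow> (real \<Rightarrow> real) \<Rightarrow> real \<Rightarrow> real" where
  "FS_integral f g = (THE F. is_continuous_extension (dyadic_integral f g) F)"

text \<open>The integral from \<open>s\<close> to \<open>t\<close> of \<open>f\<close> against \<open>g\<close>, with no order required between \<open>s\<close> and \<open>t\<close>.\<close>

definition FS_integral_between ::
    "real \<Rightarrow> real \<Rightarrow> (real \<Rightarrow> real) \<Rightarrow> (real \<Rightarrow> real) \<Rightarrow> real" where
  "FS_integral_between s t f g = FS_integral f g t - FS_integral f g s"

lemma dyadic_grid_Suc: "dyadic_grid n \<subseteq> dyadic_grid (Suc n)"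
proof
  fix t assume "t \<in> dyadic_grid n"
  then obtain k where k: "k \<le> 2 ^ n" "t = dyadic_pt n k"
    unfolding dyadic_grid_def by blast
  have "t = dyadic_pt (Suc n) (2 * k)" "2 * k \<le> 2 ^ Suc n"
    using k by (simp_all add: dyadic_pt_def)
  then show "t \<in> dyadic_grid (Suc n)"
    unfolding dyadic_grid_def by blast
qed

lemma two_power_mult_dyadic:
  assumes "t \<in> dyadics" "dyadic_level t \<le> n"
  shows "real (nat \<lfloor>2 ^ n * t\<rfloor>) = 2 ^ n * t"
proof -
  have "t \<in> dyadic_grid (dyadic_level t)"
    using assms(1) unfolding dyadics_def dyadic_level_def by (auto intro: LeastI)
  then have "t \<in> dyadic_grid n"
    using lift_Suc_mono_le[of dyadic_grid, OF dyadic_grid_Suc assms(2)] by blast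
  then show ?thesis
    by (auto simp: dyadic_grid_def dyadic_pt_def)
qed

lemma dyadics_subset: "dyadics \<subseteq> {0..1}"
proof
  fix t assume "t \<in> dyadics"
  then obtain n k where k: "k \<le> 2 ^ n" "t = real k / 2 ^ n"
    by (auto simp: dyadics_def dyadic_grid_def dyadic_pt_def)
  have "real k \<le> 2 ^ n"
    using k(1) by (metis of_nat_le_iff of_nat_numeral of_nat_power)
  then show "t \<in> {0..1}" using k(2) by simp
qed

lemma dyadics_dense: "{0..1} \<subseteq> closure dyadics"
proof
  fix x :: real assume x: "x \<in> {0..1}"
  define X where "X = (\<lambda>n. dyadic_pt n (nat \<lfloor>2 ^ n * x\<rfloor>))"
  have mem: "X n \<in> dyadics" for n
  proof -
    have "\<lfloor>2 ^ n * x\<rfloor> \<le> \<lfloor>2 ^ n :: real\<rfloor>"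
      using x by (intro floor_mono) (simp add: mult_left_le)
    also have "\<lfloor>2 ^ n :: real\<rfloor> = int (2 ^ n)"
      by (metis floor_of_nat of_nat_numeral of_nat_power)
    finally have "nat \<lfloor>2 ^ n * x\<rfloor> \<le> 2 ^ n" by linarith
    then show ?thesis unfolding X_def dyadics_def dyadic_grid_def by blast
  qed
  have near: "\<bar>X n - x\<bar> \<le> (1 / 2) ^ n" for n
  proof -
    have eq: "real (nat \<lfloor>2 ^ n * x\<rfloor>) = of_int \<lfloor>2 ^ n * x\<rfloor>"
      using x by simp
    have "\<bar>of_int \<lfloor>2 ^ n * x\<rfloor> - 2 ^ n * x\<bar> \<le> 1" by linarith
    moreover have "X n - x = (of_int \<lfloor>2 ^ n * x\<rfloor> - 2 ^ n * x) / 2 ^ n"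
      unfolding X_def dyadic_pt_def eq by (simp add: field_simps)
    ultimately show ?thesis
      by (simp add: abs_divide power_divide divide_right_mono)
  qed
  have "(\<lambda>n. X n - x) \<longlonglongrightarrow> 0"
    by (rule tendsto_0_le[where K = 1 and f = "\<lambda>n. (1 / 2 :: real) ^ n"])
       (use near in \<open>auto intro!: LIMSEQ_power_zero always_eventually\<close>)
  then have "X \<longlonglongrightarrow> x" by (simp add: LIM_zero_iff)
  then show "x \<in> closure dyadics"
    using mem closure_sequential by blast
qed

lemma continuous_extension_unique:
  assumes F: "is_continuous_extension h F" and G: "is_continuous_extension h G"
  shows "F = G"
proof (rule extensionalityI[of _ "{0..1}"])
  show "F \<in> extensional {0..1}" "G \<in> extensional {0..1}"
    using F G by (simp_all add: is_continuous_extension_def)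
  have cl: "closure dyadics = {0..1}"
    using dyadics_dense closure_minimal[OF dyadics_subset] by auto
  fix x :: real assume "x \<in> {0..1}"
  then have "F x - G x = 0"
    using F G
    by (intro continuous_constant_on_closure[of dyadics "\<lambda>x. F x - G x" 0 x])
       (auto simp: cl is_continuous_extension_def intro!: continuous_intros)
  then show "F x = G x" by simp
qed

end

theory Submission
  imports Defs
begin

text \<open>
  Both linearity claims have one source: every dyadic left sum is bilinear in the pair \<open>(f, g)\<close>, and
  the integral arises from the left sums by two operations that respect linear combinations, first
  the limit over the dyadic level at a fixed dyadic point and then the continuous extension from the
  dyadic points to \<open>[0,1]\<close>. So only the following matters about an integral \<open>\<integral> f dg\<close>: at every
  level and every point its left sum is a fixed linear combination of the left sums of two
  integrals that exist. Lemma \<open>FS_integral_linear_combination\<close> derives existence and the value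
  of \<open>\<integral> f dg\<close> from this; it applies to the integrand and to the integrator alike. The candidate
  for the extension is the linear combination of the two given extensions, and it is the right one
  because the dyadic points are dense.

  Additivity over intervals is no statement about sums at all: the integral from \<open>s\<close> to \<open>t\<close> is by
  definition an increment of one function, and increments telescope.
\<close>

lemma left_sum_linear_integrand:
  "left_sum n t (\<lambda>x. a * f1 x + b * f2 x) g = a * left_sum n t f1 g + b * left_sum n t f2 g"
  unfolding left_sum_def sum_distrib_left sum.distrib[symmetric]
  by (simp add: algebra_simps)

lemma left_sum_linear_integrator:
  "left_sum n t f (\<lambda>x. a * g1 x + b * g2 x) = a * left_sum n t f g1 + b * left_sum n t f g2"
  unfolding left_sum_def sum_distrib_left sum.distrib[symmetric]
  by (simp add: algebra_simps)

lemma dyadic_integral_LIMSEQ: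
  assumes "dyadic_integral_exists f g t"
  shows "(\<lambda>m. left_sum (dyadic_level t + m) t f g) \<longlonglongrightarrow> dyadic_integral f g t"
  using assms by (simp add: dyadic_integral_exists_def dyadic_integral_def convergent_LIMSEQ_iff)

lemma FS_integral_eqI:
  assumes "is_continuous_extension (dyadic_integral f g) F"
  shows "FS_integral f g = F"
  unfolding FS_integral_def
proof (rule the_equality)
  show "is_continuous_extension (dyadic_integral f g) F" by (rule assms)
  show "G = F" if "is_continuous_extension (dyadic_integral f g) G" for G
    using that assms by (rule continuous_extension_unique)
qed

lemma FS_integral_is_continuous_extension:
  assumes "FS_integral_exists f g"
  shows "is_continuous_extension (dyadic_integral f g) (FS_integral f g)"
  using assms FS_integral_eqI by (auto simp: FS_integral_exists_def)

text \<open>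
  The integral on the left is tied to the other two only through its left sums, so that linearity
  in the integrand and linearity in the integrator are both instances. The relation passes to the
  limit at each dyadic point; there the linear combination of the two extensions then agrees with
  the dyadic integral, and uniqueness of the continuous extension identifies it with the integral.
\<close>

lemma FS_integral_linear_combination:
  assumes sums: "\<And>n t. left_sum n t f g = a * left_sum n t f1 g1 + b * left_sum n t f2 g2"
    and ex1: "FS_integral_exists f1 g1" and ex2: "FS_integral_exists f2 g2"
  shows "FS_integral_exists f g"
    and "\<And>t. t \<in> {0..1} \<Longrightarrow> FS_integral f g t = a * FS_integral f1 g1 t + b * FS_integral f2 g2 t"
proof -
  have lim: "(\<lambda>m. left_sum (dyadic_level t + m) t f g)
      \<longlonglongrightarrow> a * dyadic_integral f1 g1 t + b * dyadic_integral f2 g2 t" if "t \<in> dyadics" for t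
    unfolding sums
    using that ex1 ex2
    by (intro tendsto_intros dyadic_integral_LIMSEQ) (auto simp: FS_integral_exists_def)
  \<comment> \<open>The restriction keeps the candidate extensional: outside \<open>[0,1]\<close> the linear combination of
    the two extensions takes an arbitrary value in place of \<open>undefined\<close>.\<close>
  define F where "F = restrict (\<lambda>t. a * FS_integral f1 g1 t + b * FS_integral f2 g2 t) {0..1}"
  have ext1: "is_continuous_extension (dyadic_integral f1 g1) (FS_integral f1 g1)"
    and ext2: "is_continuous_extension (dyadic_integral f2 g2) (FS_integral f2 g2)"
    using ex1 ex2 by (auto intro: FS_integral_is_continuous_extension)
  have ext: "is_continuous_extension (dyadic_integral f g) F"
    unfolding is_continuous_extension_def
  proof (intro conjI ballI)
    show "F \<in> extensional {0..1}" by (simp add: F_def)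
    have "continuous_on {0..1} (\<lambda>t. a * FS_integral f1 g1 t + b * FS_integral f2 g2 t)"
      using ext1 ext2 by (intro continuous_intros) (auto simp: is_continuous_extension_def)
    then show "continuous_on {0..1} F"
      by (rule continuous_on_eq) (simp add: F_def)
  next
    fix t assume t: "t \<in> dyadics"
    have "dyadic_integral f g t = a * dyadic_integral f1 g1 t + b * dyadic_integral f2 g2 t"
      unfolding dyadic_integral_def[of f g] using lim[OF t] by (rule limI)
    moreover have "t \<in> {0..1}" using t dyadics_subset by blast
    ultimately show "F t = dyadic_integral f g t"
      using t ext1 ext2 by (simp add: F_def is_continuous_extension_def)
  qed
  then show "FS_integral_exists f g"
    using lim by (auto simp: FS_integral_exists_def dyadic_integral_exists_def convergent_def)
  show "FS_integral f g t = a * FS_integral f1 g1 t + b * FS_integral f2 g2 t"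
    if "t \<in> {0..1}" for t
    using that FS_integral_eqI[OF ext] by (simp add: F_def)
qed

theorem proposition3p14:
  shows
   "(\<forall>(f1 :: real \<Rightarrow> real) (f2 :: real \<Rightarrow> real) (g :: real \<Rightarrow> real) (\<alpha> :: real) (\<beta> :: real).
       continuous_on {0..1} f1 \<and> continuous_on {0..1} f2 \<and> continuous_on {0..1} g \<and>
       FS_integral_exists f1 g \<and> FS_integral_exists f2 g \<longrightarrow>
         FS_integral_exists (\<lambda>x. \<alpha> * f1 x + \<beta> * f2 x) g \<and>
         (\<forall>t\<in>{0..1}. FS_integral (\<lambda>x. \<alpha> * f1 x + \<beta> * f2 x) g t =
            \<alpha> * FS_integral f1 g t + \<beta> * FS_integral f2 g t) \<and>
         (\<forall>s\<in>{0..1}. \<forall>t\<in>{0..1}. FS_integral_between s t (\<lambda>x. \<alpha> * f1 x + \<beta> * f2 x) g =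
            \<alpha> * FS_integral_between s t f1 g + \<beta> * FS_integral_between s t f2 g))
    \<and>
    (\<forall>(f :: real \<Rightarrow> real) (g1 :: real \<Rightarrow> real) (g2 :: real \<Rightarrow> real) (\<alpha> :: real) (\<beta> :: real).
       continuous_on {0..1} f \<and> continuous_on {0..1} g1 \<and> continuous_on {0..1} g2 \<and>
       FS_integral_exists f g1 \<and> FS_integral_exists f g2 \<longrightarrow>
         FS_integral_exists f (\<lambda>x. \<alpha> * g1 x + \<beta> * g2 x) \<and>
         (\<forall>t\<in>{0..1}. FS_integral f (\<lambda>x. \<alpha> * g1 x + \<beta> * g2 x) t =
            \<alpha> * FS_integral f g1 t + \<beta> * FS_integral f g2 t) \<and>
         (\<forall>s\<in>{0..1}. \<forall>t\<in>{0..1}. FS_integral_between s t f (\<lambda>x. \<alpha> * g1 x + \<beta> * g2 x) =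
            \<alpha> * FS_integral_between s t f g1 + \<beta> * FS_integral_between s t f g2))
    \<and>
    (\<forall>(f :: real \<Rightarrow> real) (g :: real \<Rightarrow> real).
       continuous_on {0..1} f \<and> continuous_on {0..1} g \<and> FS_integral_exists f g \<longrightarrow>
         (\<forall>r\<in>{0..1}. \<forall>s\<in>{0..1}. \<forall>t\<in>{0..1}.
            FS_integral_between r t f g = FS_integral_between r s f g + FS_integral_between s t f g) \<and>
         (\<forall>s\<in>{0..1}. FS_integral_between s s f g = 0) \<and>
         (\<forall>s\<in>{0..1}. \<forall>t\<in>{0..1}. FS_integral_between s t f g = - FS_integral_between t s f g))"
proof (intro conjI allI impI)
  fix f1 f2 g :: "real \<Rightarrow> real" and \<alpha> \<beta> :: real
  assume "continuous_on {0..1} f1 \<and> continuous_on {0..1} f2 \<and> continuous_on {0..1} g \<and>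
    FS_integral_exists f1 g \<and> FS_integral_exists f2 g"
  then have ex: "FS_integral_exists f1 g" "FS_integral_exists f2 g" by auto
  note lin = FS_integral_linear_combination[OF left_sum_linear_integrand ex, where a = \<alpha> and b = \<beta>]
  show "FS_integral_exists (\<lambda>x. \<alpha> * f1 x + \<beta> * f2 x) g" by (rule lin(1))
  show "\<forall>t\<in>{0..1}. FS_integral (\<lambda>x. \<alpha> * f1 x + \<beta> * f2 x) g t =
      \<alpha> * FS_integral f1 g t + \<beta> * FS_integral f2 g t"
    using lin(2) by blast
  then show "\<forall>s\<in>{0..1}. \<forall>t\<in>{0..1}. FS_integral_between s t (\<lambda>x. \<alpha> * f1 x + \<beta> * f2 x) g =
      \<alpha> * FS_integral_between s t f1 g + \<beta> * FS_integral_between s t f2 g"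
    by (simp add: FS_integral_between_def algebra_simps)
next
  fix f g1 g2 :: "real \<Rightarrow> real" and \<alpha> \<beta> :: real
  assume "continuous_on {0..1} f \<and> continuous_on {0..1} g1 \<and> continuous_on {0..1} g2 \<and>
    FS_integral_exists f g1 \<and> FS_integral_exists f g2"
  then have ex: "FS_integral_exists f g1" "FS_integral_exists f g2" by auto
  note lin = FS_integral_linear_combination[OF left_sum_linear_integrator ex, where a = \<alpha> and b = \<beta>]
  show "FS_integral_exists f (\<lambda>x. \<alpha> * g1 x + \<beta> * g2 x)" by (rule lin(1))
  show "\<forall>t\<in>{0..1}. FS_integral f (\<lambda>x. \<alpha> * g1 x + \<beta> * g2 x) t =
      \<alpha> * FS_integral f g1 t + \<beta> * FS_integral f g2 t"
    using lin(2) by blast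
  then show "\<forall>s\<in>{0..1}. \<forall>t\<in>{0..1}. FS_integral_between s t f (\<lambda>x. \<alpha> * g1 x + \<beta> * g2 x) =
      \<alpha> * FS_integral_between s t f g1 + \<beta> * FS_integral_between s t f g2"
    by (simp add: FS_integral_between_def algebra_simps)
qed (simp_all add: FS_integral_between_def)

end
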